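(* Assume (Pur) and (Erg) hold. Let $0<\alpha\le1$ and $h\in C^\alpha(\mathrm P(\mathbb C^k),\mathbb R)$. Then for every $z\in\mathbb C$ the operator $\Pi_z$ is a bounded endomorphism of $C^\alpha(\mathrm P(\mathbb C^k),\mathbb C)$, and the map $z\mapsto\Pi_z$ (with values in the Banach space of bounded endomorphisms of $C^\alpha(\mathrm P(\mathbb C^k),\mathbb C)$) is analytic on $\mathbb C$.
   Context: Let $k\in\mathbb N=\{1,2,\dots\}$ be fixed; $\mathbb C^k$ carries its canonical inner product and norm $\|\cdot\|$. $\mathrm P(\mathbb C^k)$ is the projective space with its Borel $\sigma$-algebra; $\hat x$ is the class of a nonzero vector $x$, and given $\hat x$, $x$ denotes a unit-norm representative. The metric is $d(\hat x,\hat y)=\sqrt{1-|\langle x,y\rangle|^2}$. For $v\in\mathrm M_k(\mathbb C)$ with $vx\ne0$, $v\cdot\hat x$ is the class of $vx$. For $0<\alpha\le1$, $C^\alpha(\mathrm P(\mathbb C^k),\mathbb C)$ is the Banach space of $\alpha$-Hölder functions with norm $\|f\|_\alpha=\|f\|_\infty+m_\alpha(f)$, $m_\alpha(f)=\sup_{\hat x\ne\hat y}|f(\hat x)-f(\hat y)|/d(\hat x,\hat y)^\alpha$; $C^\alpha(\mathrm P(\mathbb C^k),\mathbb R)$ denotes the real-valued ones. $\mu$ is a (not necessarily finite) Borel measure on $\mathrm M_k(\mathbb C)$ with $\int\|v\|^2d\mu(v)<\infty$ and $\int v^*v\,d\mu(v)=\mathrm{Id}_{\mathbb C^k}$. For $z\in\mathbb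 C$, $\Pi_zf(\hat x)=\int_{\mathrm M_k(\mathbb C)}e^{zh(v\cdot\hat x)}f(v\cdot\hat x)\|vx\|^2d\mu(v)$, with the integrand set to $0$ when $vx=0$. (Pur): any nonzero orthogonal projector $\pi$ on $\mathbb C^k$ such that, for every $n\in\mathbb N$, $\pi v_1^*\cdots v_n^*v_n\cdots v_1\pi\propto\pi$ (proportionality constant $0$ allowed) for $\mu^{\otimes n}$-almost every $(v_1,\dots,v_n)$, is of rank one. (Erg): there exists a unique minimal subspace $E\ne\{0\}$ of $\mathbb C^k$ such that $vE\subset E$ for $\mu$-almost every $v$. *)

theory Defs
  imports "HOL-Analysis.Analysis"
begin

definition cinner :: "complex^'k \<Rightarrow> complex^'k \<Rightarrow> complex" where
  "cinner x y = (\<Sum>i\<in>UNIV. cnj (x $ i) * y $ i)"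

definition cadjoint :: "complex^'m^'n \<Rightarrow> complex^'n^'m" where
  "cadjoint A = (\<chi> i j. cnj (A $ j $ i))"

lemma cinner_self: "cinner x x = complex_of_real ((norm x)\<^sup>2)"
proof -
  have "cinner x x = (\<Sum>i\<in>UNIV. complex_of_real ((cmod (x $ i))\<^sup>2))"
    unfolding cinner_def by (intro sum.cong refl) (simp only: complex_norm_square mult.commute)
  then show ?thesis
    by (simp add: norm_vec_def L2_set_def sum_nonneg)
qed

lemma norm_smult_complex: "norm (c *s x) = cmod c * norm (x :: complex^'k)"
  by (simp add: norm_vec_def norm_mult L2_set_right_distrib)

definition same_line :: "complex^'k \<Rightarrow> complex^'k \<Rightarrow> bool" where
  "same_line x y \<longleftrightarrow> x \<noteq> 0 \<and> y \<noteq> 0 \<and> (\<exists>c. y = c *s x)"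

lemma same_line_self: "same_line x x \<longleftrightarrow> x \<noteq> 0"
  by (auto simp: same_line_def vec_eq_iff intro!: exI[of _ 1])

lemma part_equivp_same_line: "part_equivp (same_line :: complex^'k \<Rightarrow> complex^'k \<Rightarrow> bool)"
proof (rule part_equivpI)
  have "vec 1 \<noteq> (0 :: complex^'k)" by (simp add: vec_eq_iff)
  then show "\<exists>x :: complex^'k. same_line x x"
    using same_line_self by blast
  show "symp (same_line :: complex^'k \<Rightarrow> complex^'k \<Rightarrow> bool)"
  proof (rule sympI)
    fix x y :: "complex^'k"
    assume "same_line x y"
    then obtain c where c: "x \<noteq> 0" "y \<noteq> 0" "y = c *s x" by (auto simp: same_line_def)
    then have "c \<noteq> 0" by auto
    then have "x = inverse c *s y" by (simp add: c(3) vec_eq_iff)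
    then show "same_line y x" using c unfolding same_line_def by blast
  qed
  show "transp (same_line :: complex^'k \<Rightarrow> complex^'k \<Rightarrow> bool)"
    unfolding same_line_def by (rule transpI) (metis vector_smult_assoc)
qed

quotient_type (overloaded) 'k cproj = "complex^('k::finite)" / partial: same_line
  morphisms rep_cproj cproj_class
  by (rule part_equivp_same_line)

lemma cproj_class_eq_iff:
  assumes "x \<noteq> 0" "y \<noteq> 0"
  shows "cproj_class x = cproj_class y \<longleftrightarrow> (\<exists>c. y = c *s x)"
  using Quotient_rel[OF Quotient_cproj, of x y] assms
  by (auto simp: same_line_self) (auto simp: same_line_def)

definition unit_rep :: "'k::finite cproj \<Rightarrow> complex^'k" where
  "unit_rep p = (SOME x. norm x = 1 \<and> cproj_class x = p)"

lemma unit_rep: "norm (unit_rep p) = 1" "cproj_class (unit_rep p) = p"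
proof -
  obtain y where y: "y \<noteq> 0" "cproj_class y = p"
    using Quotient_abs_rep[OF Quotient_cproj, of p] Quotient_rep_reflp[OF Quotient_cproj, of p]
    unfolding same_line_self by blast
  define x where "x = complex_of_real (inverse (norm y)) *s y"
  have n: "norm x = 1" using y by (simp add: x_def norm_smult_complex norm_inverse)
  then have "x \<noteq> 0" by auto
  then have "cproj_class x = p"
    using y cproj_class_eq_iff[of y x] unfolding x_def by metis
  with n have "\<exists>x. norm x = 1 \<and> cproj_class x = p" by blast
  from someI_ex[OF this]
  show "norm (unit_rep p) = 1" "cproj_class (unit_rep p) = p"
    unfolding unit_rep_def by blast+
qed

lemma unit_rep_cproj_class:
  assumes "x \<noteq> 0"
  obtains c where "cmod c * norm x = 1" "unit_rep (cproj_class x) = c *s x"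
proof -
  have "unit_rep (cproj_class x) \<noteq> 0"
    using unit_rep(1)[of "cproj_class x"] by auto
  then obtain c where c: "unit_rep (cproj_class x) = c *s x"
    using cproj_class_eq_iff[OF assms] unit_rep(2)[of "cproj_class x"] by metis
  with unit_rep(1)[of "cproj_class x"] have "cmod c * norm x = 1"
    by (simp add: norm_smult_complex)
  with c that show ?thesis by blast
qed

text \<open>The triangle inequality for the metric below comes from the isometric (up to the factor
  \<open>sqrt 2\<close>) embedding of projective space into matrices by rank-one projectors.\<close>

definition ray :: "complex^'k \<Rightarrow> complex^'k^'k" where
  "ray x = (\<chi> i j. x $ i * cnj (x $ j))"

lemma norm_matrix_square:
  "(norm (A :: complex^'k^'k))\<^sup>2 = (\<Sum>i\<in>UNIV. \<Sum>j\<in>UNIV. (cmod (A $ i $ j))\<^sup>2)"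
  by (simp add: norm_vec_def L2_set_def sum_nonneg)

lemma norm_ray_diff:
  assumes "norm x = 1" "norm y = 1"
  shows "(norm (ray x - ray y))\<^sup>2 = 2 * (1 - (cmod (cinner x y))\<^sup>2)"
proof -
  have *: "complex_of_real ((cmod (ray x $ i $ j - ray y $ i $ j))\<^sup>2) =
      (cnj (x$i) * x$i) * (cnj (x$j) * x$j) + (cnj (y$i) * y$i) * (cnj (y$j) * y$j)
      - (cnj (x$i) * y$i) * (cnj (y$j) * x$j) - (cnj (y$i) * x$i) * (cnj (x$j) * y$j)" for i j
    unfolding complex_norm_square by (simp add: ray_def algebra_simps)
  have split: "(\<Sum>i\<in>UNIV. \<Sum>j\<in>UNIV. (cnj (a$i) * b$i) * (cnj (c$j) * d$j))
      = cinner a b * cinner c d" for a b c d :: "complex^'a"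
    by (simp add: cinner_def sum_product)
  have cc: "cinner y x = cnj (cinner x y)"
    by (simp add: cinner_def mult.commute)
  have "complex_of_real ((norm (ray x - ray y))\<^sup>2) =
      cinner x x * cinner x x + cinner y y * cinner y y
      - cinner x y * cinner y x - cinner y x * cinner x y"
    unfolding norm_matrix_square of_real_sum vector_minus_component *
    by (simp only: sum.distrib sum_subtractf split)
  also have "\<dots> = complex_of_real (2 * (1 - (cmod (cinner x y))\<^sup>2))"
    using assms unfolding cc of_real_mult of_real_diff complex_norm_square by (simp add: cinner_self)
  finally show ?thesis
    using of_real_eq_iff by blast
qed

lemma ray_mult: "ray x *v y = cinner x y *s x"
  by (simp add: vec_eq_iff ray_def matrix_vector_mult_def cinner_def sum_distrib_left mult_ac)

instantiation cproj :: (finite) metric_space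
begin

definition dist_cproj :: "'a cproj \<Rightarrow> 'a cproj \<Rightarrow> real" where
  "dist_cproj p q = sqrt (1 - (cmod (cinner (unit_rep p) (unit_rep q)))\<^sup>2)"

definition uniformity_cproj :: "('a cproj \<times> 'a cproj) filter" where
  "uniformity_cproj = (INF e\<in>{0<..}. principal {(p, q). dist p q < e})"

definition open_cproj :: "'a cproj set \<Rightarrow> bool" where
  "open_cproj U \<longleftrightarrow> (\<forall>p\<in>U. eventually (\<lambda>(p', q). p' = p \<longrightarrow> q \<in> U) uniformity)"

lemma dist_cproj_ray:
  "dist p q = norm (ray (unit_rep p) - ray (unit_rep q)) / sqrt 2" for p q :: "'a cproj"
proof -
  have "1 - (cmod (cinner (unit_rep p) (unit_rep q)))\<^sup>2
      = (norm (ray (unit_rep p) - ray (unit_rep q)))\<^sup>2 / 2"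
    by (simp add: norm_ray_diff unit_rep)
  then show ?thesis
    unfolding dist_cproj_def by (simp only: real_sqrt_divide) simp
qed

instance
proof
  fix p q r :: "'a cproj"
  show "dist p q = 0 \<longleftrightarrow> p = q"
  proof
    assume "dist p q = 0"
    then have "ray (unit_rep p) *v unit_rep p = ray (unit_rep q) *v unit_rep p"
      by (simp add: dist_cproj_ray)
    then have eq: "unit_rep p = cinner (unit_rep q) (unit_rep p) *s unit_rep q"
      by (simp add: ray_mult cinner_self unit_rep)
    have nz: "unit_rep p \<noteq> 0" "unit_rep q \<noteq> 0"
      using unit_rep(1)[of p] unit_rep(1)[of q] by auto
    have "cproj_class (unit_rep q) = cproj_class (unit_rep p)"
      unfolding cproj_class_eq_iff[OF nz(2,1)] using eq by (rule exI)
    then show "p = q" by (simp add: unit_rep)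
  qed (simp add: dist_cproj_ray)
  have "norm (ray (unit_rep p) - ray (unit_rep q)) \<le>
      norm (ray (unit_rep p) - ray (unit_rep r)) + norm (ray (unit_rep q) - ray (unit_rep r))"
    by (metis norm_triangle_ineq4 diff_diff_eq2 diff_add_cancel)
  then show "dist p q \<le> dist p r + dist q r"
    unfolding dist_cproj_ray add_divide_distrib[symmetric] by (rule divide_right_mono) simp
qed (simp_all add: uniformity_cproj_def open_cproj_def)

end

lemma dist_cproj_class:
  assumes "norm x = 1" "norm y = 1"
  shows "dist (cproj_class x) (cproj_class y) = sqrt (1 - (cmod (cinner x y))\<^sup>2)"
proof -
  have "x \<noteq> 0" "y \<noteq> 0" using assms by auto
  then obtain c d where cd: "cmod c = 1" "unit_rep (cproj_class x) = c *s x"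
      "cmod d = 1" "unit_rep (cproj_class y) = d *s y"
    using assms by (metis unit_rep_cproj_class mult_cancel_left1 mult.commute)
  have "cinner (c *s x) (d *s y) = cnj c * d * cinner x y"
    by (simp add: cinner_def sum_distrib_left algebra_simps)
  then show ?thesis by (simp add: dist_cproj_def cd norm_mult)
qed

lemma dist_cproj_le_1: "dist p q \<le> 1" for p q :: "'k::finite cproj"
  by (simp add: dist_cproj_def)

text \<open>Only meaningful if \<open>v\<close> does not annihilate the line \<open>p\<close>.\<close>

definition proj_act :: "complex^'k^'k \<Rightarrow> 'k::finite cproj \<Rightarrow> 'k cproj" where
  "proj_act v p = cproj_class (v *v unit_rep p)"

lemma matrix_vector_smult: "v *v (c *s x) = c *s (v *v x)" for v :: "complex^'k^'k"
  by (simp add: vec_eq_iff matrix_vector_mult_def sum_distrib_left mult.left_commute)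

lemma proj_act_cproj_class:
  assumes "v *v x \<noteq> 0"
  shows "proj_act v (cproj_class x) = cproj_class (v *v x)"
proof -
  have "x \<noteq> 0" using assms by auto
  then obtain c where c: "cmod c * norm x = 1" "unit_rep (cproj_class x) = c *s x"
    by (rule unit_rep_cproj_class)
  then have "c \<noteq> 0" by auto
  then have "c *s (v *v x) \<noteq> 0" using assms by (simp add: vec_eq_iff)
  then show ?thesis
    using cproj_class_eq_iff[OF assms, of "c *s (v *v x)"]
    by (auto simp: proj_act_def c matrix_vector_smult)
qed

lemma norm_mult_unit_rep:
  fixes v :: "complex^'k^'k"
  assumes "norm x = 1"
  shows "norm (v *v unit_rep (cproj_class x)) = norm (v *v x)"
proof -
  have "x \<noteq> 0" using assms by auto
  then obtain c where "cmod c * norm x = 1" "unit_rep (cproj_class x) = c *s x"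
    by (rule unit_rep_cproj_class)
  with assms show ?thesis by (simp add: matrix_vector_smult norm_smult_complex)
qed

text \<open>Projective space has diameter at most 1, so Hoelder functions are bounded.\<close>

definition holder_space :: "real \<Rightarrow> ('k::finite cproj \<Rightarrow> 'b::real_normed_vector) set" where
  "holder_space \<alpha> = {f. \<exists>C. \<forall>x y. norm (f x - f y) \<le> C * dist x y powr \<alpha>}"

text \<open>The element 0 is inserted for the one-point projective space, where the supremum defining
  the seminorm runs over the empty set.\<close>

definition holder_seminorm :: "real \<Rightarrow> ('k::finite cproj \<Rightarrow> 'b::real_normed_vector) \<Rightarrow> real" where
  "holder_seminorm \<alpha> f =
    Sup (insert 0 {norm (f x - f y) / dist x y powr \<alpha> | x y. x \<noteq> y})"

definition holder_norm :: "real \<Rightarrow> ('k::finite cproj \<Rightarrow> 'b::real_normed_vector) \<Rightarrow> real" where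
  "holder_norm \<alpha> f = (SUP x. norm (f x)) + holder_seminorm \<alpha> f"

type_synonym 'k fun_op = "('k cproj \<Rightarrow> complex) \<Rightarrow> ('k cproj \<Rightarrow> complex)"

text \<open>Operators are total on functions; only their values on \<open>holder_space \<alpha>\<close> matter.\<close>

definition bounded_endos :: "real \<Rightarrow> ('k::finite fun_op) set" where
  "bounded_endos \<alpha> = {T.
     (\<forall>f\<in>holder_space \<alpha>. T f \<in> holder_space \<alpha>) \<and>
     (\<forall>f\<in>holder_space \<alpha>. \<forall>g\<in>holder_space \<alpha>. T (\<lambda>x. f x + g x) = (\<lambda>x. T f x + T g x)) \<and>
     (\<forall>c. \<forall>f\<in>holder_space \<alpha>. T (\<lambda>x. c * f x) = (\<lambda>x. c * T f x)) \<and>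
     (\<exists>K. \<forall>f\<in>holder_space \<alpha>. holder_norm \<alpha> (T f) \<le> K * holder_norm \<alpha> f)}"

definition endo_norm :: "real \<Rightarrow> 'k::finite fun_op \<Rightarrow> real" where
  "endo_norm \<alpha> T = (SUP f\<in>{f \<in> holder_space \<alpha>. holder_norm \<alpha> f \<le> 1}. holder_norm \<alpha> (T f))"

text \<open>Locally a norm-convergent power series with coefficients in the bounded endomorphisms.\<close>

definition endo_analytic_on ::
    "real \<Rightarrow> (complex \<Rightarrow> 'k::finite fun_op) \<Rightarrow> complex set \<Rightarrow> bool" where
  "endo_analytic_on \<alpha> F S \<longleftrightarrow> (\<forall>z0\<in>S. \<exists>r>0. \<exists>A :: nat \<Rightarrow> 'k fun_op.
     (\<forall>n. A n \<in> bounded_endos \<alpha>) \<and>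
     (\<forall>z\<in>ball z0 r.
       (\<lambda>N. endo_norm \<alpha> (\<lambda>f x. F z f x - (\<Sum>n<N. (z - z0) ^ n * A n f x))) \<longlonglongrightarrow> 0))"

definition tilted_integrand ::
    "('k::finite cproj \<Rightarrow> real) \<Rightarrow> complex \<Rightarrow> ('k cproj \<Rightarrow> complex) \<Rightarrow> 'k cproj
      \<Rightarrow> complex^'k^'k \<Rightarrow> complex" where
  "tilted_integrand h z f p v =
    (if v *v unit_rep p = 0 then 0
     else exp (z * complex_of_real (h (proj_act v p))) * f (proj_act v p)
            * complex_of_real ((norm (v *v unit_rep p))\<^sup>2))"

definition tilted_op ::
    "(complex^'k^'k) measure \<Rightarrow> ('k::finite cproj \<Rightarrow> real) \<Rightarrow> complex \<Rightarrow> 'k fun_op" where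
  "tilted_op \<mu> h z f p = (LINT v|\<mu>. tilted_integrand h z f p v)"

text \<open>\<open>word_prod v n = v\<^sub>n \<cdots> v\<^sub>1\<close>\<close>

primrec word_prod :: "(nat \<Rightarrow> complex^'k^'k) \<Rightarrow> nat \<Rightarrow> complex^'k^'k" where
  "word_prod v 0 = mat 1"
| "word_prod v (Suc n) = v (Suc n) ** word_prod v n"

definition orth_projector :: "complex^'k^'k \<Rightarrow> bool" where
  "orth_projector P \<longleftrightarrow> P ** P = P \<and> cadjoint P = P"

text \<open>No sigma-finiteness of \<open>\<mu>\<close> is required. If \<open>\<parallel>v\<parallel>\<^sup>2\<close> is integrable then \<open>\<mu>\<close> is sigma-finite away
  from the zero matrix, so the product measure is determined on tuples of nonzero matrices; on all
  other tuples the proportionality below holds trivially with constant 0.\<close>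

definition Pur :: "(complex^'k^'k) measure \<Rightarrow> bool" where
  "Pur \<mu> \<longleftrightarrow> (\<forall>P :: complex^'k^'k.
     orth_projector P \<and> P \<noteq> 0 \<and>
     (\<forall>n\<ge>1. AE v in Pi\<^sub>M {1..n} (\<lambda>_. \<mu>).
        \<exists>c. P ** cadjoint (word_prod v n) ** word_prod v n ** P = mat c ** P)
     \<longrightarrow> rank P = 1)"

definition invariant_subspace :: "(complex^'k^'k) measure \<Rightarrow> (complex^'k) set \<Rightarrow> bool" where
  "invariant_subspace \<mu> E \<longleftrightarrow> vec.subspace E \<and> E \<noteq> {0} \<and> (AE v in \<mu>. (*v) v ` E \<subseteq> E)"

definition Erg :: "(complex^'k^'k) measure \<Rightarrow> bool" where
  "Erg \<mu> \<longleftrightarrow> (\<exists>!E. invariant_subspace \<mu> E \<and>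
     (\<forall>F. invariant_subspace \<mu> F \<and> F \<subseteq> E \<longrightarrow> F = E))"

end

theory Submission
  imports Defs
begin

text \<open>
  Let \<open>T\<close> be the untilted operator,
  \<open>T g (p) = \<integral> g (v \<cdot> p) \<parallel>v x\<parallel>\<^sup>2 d\<mu>(v)\<close> with \<open>x\<close> a unit vector on the line \<open>p\<close>. The tilt is only
  a multiplication: \<open>\<Pi>\<^sub>z f = T (exp (z h) f)\<close>. Since the Hoelder space is a normed algebra, everything
  follows from two facts: \<open>T\<close> is bounded on it, and \<open>z \<mapsto> exp (z h)\<close> is analytic as a map into it.

  Boundedness of \<open>T\<close>. The action of \<open>v\<close> on projective space has no uniform Lipschitz constant,
  because it expands near the kernel of \<open>v\<close>: one only has
  \<open>d (v \<cdot> p, v \<cdot> q) \<le> \<parallel>v\<parallel> d (p, q) / \<parallel>v x\<parallel>\<close> (lemma \<open>dist_proj_act_le\<close>). The weight \<open>\<parallel>v x\<parallel>\<^sup>2\<close>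
  compensates for that, as \<open>\<alpha> \<le> 1 \<le> 2\<close>:
  \<open>\<parallel>v x\<parallel>\<^sup>2 (\<parallel>v\<parallel> d / \<parallel>v x\<parallel>)\<^sup>\<alpha> \<le> \<parallel>v\<parallel>\<^sup>2 d\<^sup>\<alpha>\<close>. The weight itself is Lipschitz with constant
  \<open>2 \<parallel>v\<parallel>\<^sup>2\<close>. So the integrand is \<open>\<alpha>\<close>-Hoelder in \<open>p\<close> with a constant proportional to \<open>\<parallel>v\<parallel>\<^sup>2\<close>
  (lemma \<open>weighted_eval_diff_le\<close>), which is integrable; this gives
  \<open>\<parallel>T g\<parallel>\<^sub>\<alpha> \<le> 3 (\<integral> \<parallel>v\<parallel>\<^sup>2 d\<mu>) \<parallel>g\<parallel>\<^sub>\<alpha>\<close> (lemma \<open>holder_transfer\<close>).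

  Analyticity. Around \<open>z\<^sub>0\<close> the coefficients of the power series are the operators
  \<open>f \<mapsto> T (h\<^sup>n / n! exp (z\<^sub>0 h) f)\<close>. The difference between \<open>\<Pi>\<^sub>z\<close> and the \<open>N\<close>-th partial sum is
  \<open>f \<mapsto> T (exp (z\<^sub>0 h) E\<^sub>N((z - z\<^sub>0) h) f)\<close>, where \<open>E\<^sub>N\<close> is the tail of the exponential series from the
  term of degree \<open>N\<close> on. Because \<open>E\<^sub>N' = E\<^sub>N\<^sub>-\<^sub>1\<close>, the tail is small together with its derivative on
  bounded sets, hence \<open>E\<^sub>N \<circ> u\<close> tends to \<open>0\<close> in the Hoelder norm for every Hoelder function \<open>u\<close>
  (lemma \<open>holder_norm_exp_tail_tendsto_0\<close>).
\<close>

section \<open>The action of a matrix on projective space\<close>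

text \<open>Pythagoras: \<open>cinner y x *s y\<close> is the orthogonal projection of \<open>x\<close> to the line of \<open>y\<close>.\<close>

lemma norm_diff_smult_unit:
  fixes x y :: "complex^'k"
  assumes "norm x = 1" "norm y = 1"
  shows "(norm (x - c *s y))\<^sup>2 = (1 - (cmod (cinner x y))\<^sup>2) + (cmod (c - cinner y x))\<^sup>2"
proof -
  have conj: "cinner y x = cnj (cinner x y)"
    by (simp add: cinner_def mult.commute)
  have "cinner (x - c *s y) (x - c *s y)
      = cinner x x - c * cinner x y - cnj c * cinner y x + cnj c * c * cinner y y"
    by (simp add: cinner_def sum_distrib_left sum.distrib sum_subtractf algebra_simps)
  then have "complex_of_real ((norm (x - c *s y))\<^sup>2)
      = 1 - c * cinner x y - cnj c * cnj (cinner x y) + cnj c * c"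
    using assms by (simp add: cinner_self conj)
  also have "\<dots> = complex_of_real ((1 - (cmod (cinner x y))\<^sup>2) + (cmod (c - cinner y x))\<^sup>2)"
    unfolding of_real_add of_real_diff complex_norm_square conj by (simp add: algebra_simps)
  finally show ?thesis
    using of_real_eq_iff by blast
qed

lemma cmod_cinner_le_1:
  assumes "norm x = 1" "norm y = 1"
  shows "cmod (cinner x y) \<le> 1"
proof -
  have "0 \<le> (norm (x - cinner y x *s y))\<^sup>2" by simp
  then show ?thesis
    unfolding norm_diff_smult_unit[OF assms] by (simp add: power_le_one_iff abs_square_le_1)
qed

text \<open>The metric is the distance from a unit vector on one line to the other line, attained at the
  orthogonal projection.\<close>

lemma obtain_nearest_on_line:
  obtains c where "cmod c \<le> 1" "norm (unit_rep p - c *s unit_rep q) = dist p q"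
proof
  show "cmod (cinner (unit_rep q) (unit_rep p)) \<le> 1"
    by (simp add: cmod_cinner_le_1 unit_rep)
  show "norm (unit_rep p - cinner (unit_rep q) (unit_rep p) *s unit_rep q) = dist p q"
    unfolding dist_cproj_def using norm_diff_smult_unit[OF unit_rep(1) unit_rep(1), of p "cinner (unit_rep q) (unit_rep p)" q]
    by (simp add: real_sqrt_unique)
qed

text \<open>By Pythagoras the distance of two lines is a minimum over the points of the second one. Any
  point may serve as a competitor, and the free scalar \<open>c\<close> makes it possible to compare images \<open>v x\<close>
  and \<open>v y\<close> through \<open>v (x - c y)\<close>.\<close>

lemma dist_cproj_class_le:
  fixes a b :: "complex^'k::finite"
  assumes "a \<noteq> 0" "b \<noteq> 0"
  shows "dist (cproj_class a) (cproj_class b) \<le> norm (a - c *s b) / norm a"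
proof -
  obtain s where s: "cmod s * norm a = 1" "unit_rep (cproj_class a) = s *s a"
    using unit_rep_cproj_class[OF assms(1)] by blast
  obtain t where t: "cmod t * norm b = 1" "unit_rep (cproj_class b) = t *s b"
    using unit_rep_cproj_class[OF assms(2)] by blast
  have t0: "t \<noteq> 0" using t by auto
  have unit: "norm (s *s a) = 1" "norm (t *s b) = 1"
    using s t by (simp_all add: norm_smult_complex)
  define c' where "c' = s * c / t"
  have "s *s a - c' *s (t *s b) = s *s (a - c *s b)"
    using t0 by (simp add: c'_def vec_eq_iff algebra_simps)
  then have eq: "norm (s *s a - c' *s (t *s b)) = norm (a - c *s b) / norm a"
    using s(1) assms(1) by (simp only: norm_smult_complex) (simp add: field_simps)
  have "1 - (cmod (cinner (s *s a) (t *s b)))\<^sup>2 \<le> (norm (s *s a - c' *s (t *s b)))\<^sup>2"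
    unfolding norm_diff_smult_unit[OF unit] by simp
  then show ?thesis
    unfolding dist_cproj_def s(2) t(2) eq[symmetric] by (rule real_le_lsqrt[rotated 1]) simp
qed

text \<open>The norm of a matrix is the Frobenius norm, so this is Cauchy--Schwarz applied to each row.\<close>

lemma norm_matrix_vector_le:
  fixes v :: "complex^'k^'m" and x :: "complex^'k"
  shows "norm (v *v x) \<le> norm v * norm x"
proof -
  have comp: "norm ((v *v x) $ i) \<le> norm (v $ i) * norm x" for i
  proof -
    have "norm ((v *v x) $ i) \<le> (\<Sum>j\<in>UNIV. \<bar>norm (v $ i $ j)\<bar> * \<bar>norm (x $ j)\<bar>)"
      by (simp add: matrix_vector_mult_def norm_mult[symmetric] norm_sum)
    also have "\<dots> \<le> L2_set (\<lambda>j. norm (v $ i $ j)) UNIV * L2_set (\<lambda>j. norm (x $ j)) UNIV"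
      by (rule L2_set_mult_ineq)
    finally show ?thesis by (simp add: norm_vec_def)
  qed
  have "norm (v *v x) \<le> L2_set (\<lambda>i. norm (v $ i) * norm x) UNIV"
    unfolding norm_vec_def[of "v *v x"] by (intro L2_set_mono comp) simp
  then show ?thesis
    by (simp add: norm_vec_def[of v] L2_set_left_distrib)
qed

lemma norm_matrix_unit_rep_le: "norm (v *v unit_rep p) \<le> norm (v :: complex^'k^'k::finite)"
  using norm_matrix_vector_le[of v "unit_rep p"] by (simp add: unit_rep)

text \<open>Write \<open>x\<close> and \<open>y\<close> for the unit representatives. With \<open>c y\<close> the point of the second line nearest
  to \<open>x\<close>, the vector \<open>v (x - c y)\<close> has norm at most \<open>\<parallel>v\<parallel> d (p, q)\<close>, and it is the difference between
  \<open>v x\<close> and a point of the line \<open>v \<cdot> q\<close>.\<close>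

lemma dist_proj_act_le:
  fixes v :: "complex^'k^'k::finite"
  assumes "v *v unit_rep p \<noteq> 0" "v *v unit_rep q \<noteq> 0"
  shows "dist (proj_act v p) (proj_act v q) \<le> norm v * dist p q / norm (v *v unit_rep p)"
proof -
  obtain c where c: "norm (unit_rep p - c *s unit_rep q) = dist p q"
    using obtain_nearest_on_line by blast
  have "dist (proj_act v p) (proj_act v q)
      \<le> norm (v *v unit_rep p - c *s (v *v unit_rep q)) / norm (v *v unit_rep p)"
    unfolding proj_act_def by (rule dist_cproj_class_le[OF assms])
  also have "v *v unit_rep p - c *s (v *v unit_rep q) = v *v (unit_rep p - c *s unit_rep q)"
    by (simp add: matrix_vector_smult matrix_vector_mult_diff_distrib)
  also have "norm \<dots> / norm (v *v unit_rep p) \<le> norm v * dist p q / norm (v *v unit_rep p)"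
    using norm_matrix_vector_le[of v "unit_rep p - c *s unit_rep q"]
    by (intro divide_right_mono) (simp_all add: c)
  finally show ?thesis .
qed

lemma norm_unit_rep_image_le:
  fixes v :: "complex^'k^'k::finite"
  shows "norm (v *v unit_rep p) \<le> norm (v *v unit_rep q) + norm v * dist p q"
proof -
  obtain c where c: "cmod c \<le> 1" "norm (unit_rep p - c *s unit_rep q) = dist p q"
    using obtain_nearest_on_line by blast
  have "v *v unit_rep p = c *s (v *v unit_rep q) + v *v (unit_rep p - c *s unit_rep q)"
    by (simp add: matrix_vector_smult matrix_vector_mult_diff_distrib)
  then have "norm (v *v unit_rep p)
      \<le> cmod c * norm (v *v unit_rep q) + norm (v *v (unit_rep p - c *s unit_rep q))"
    by (metis norm_triangle_ineq norm_smult_complex)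
  moreover have "cmod c * norm (v *v unit_rep q) \<le> 1 * norm (v *v unit_rep q)"
    using c(1) by (intro mult_right_mono) auto
  moreover have "norm (v *v (unit_rep p - c *s unit_rep q)) \<le> norm v * dist p q"
    using norm_matrix_vector_le[of v "unit_rep p - c *s unit_rep q"] by (simp add: c)
  ultimately show ?thesis by linarith
qed

text \<open>The length \<open>\<parallel>v x\<parallel>\<close> is Lipschitz in the line of \<open>x\<close> with constant \<open>\<parallel>v\<parallel>\<close>; the square costs the
  factor \<open>\<parallel>v x\<parallel> + \<parallel>v y\<parallel> \<le> 2 \<parallel>v\<parallel>\<close>.\<close>

lemma weight_diff_le:
  fixes v :: "complex^'k^'k::finite"
  shows "\<bar>(norm (v *v unit_rep p))\<^sup>2 - (norm (v *v unit_rep q))\<^sup>2\<bar> \<le> 2 * (norm v)\<^sup>2 * dist p q"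
proof -
  let ?a = "norm (v *v unit_rep p)" and ?b = "norm (v *v unit_rep q)"
  have "\<bar>?a - ?b\<bar> \<le> norm v * dist p q"
    using norm_unit_rep_image_le[of v p q] norm_unit_rep_image_le[of v q p]
    by (simp add: dist_commute)
  moreover have "?a + ?b \<le> 2 * norm v"
    using norm_matrix_unit_rep_le[of v p] norm_matrix_unit_rep_le[of v q] by simp
  ultimately have "\<bar>?a - ?b\<bar> * (?a + ?b) \<le> (norm v * dist p q) * (2 * norm v)"
    by (intro mult_mono) auto
  moreover have "?a\<^sup>2 - ?b\<^sup>2 = (?a - ?b) * (?a + ?b)"
    by (simp add: power2_eq_square square_diff_square_factored mult.commute)
  then have "\<bar>?a\<^sup>2 - ?b\<^sup>2\<bar> = \<bar>?a - ?b\<bar> * (?a + ?b)"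
    by (simp only: abs_mult) simp
  ultimately show ?thesis
    by (simp add: power2_eq_square mult_ac)
qed

section \<open>The algebra of Hoelder functions\<close>

lemma powr_dist_le_1: "0 < \<alpha> \<Longrightarrow> dist p q powr \<alpha> \<le> 1" for p q :: "'k::finite cproj"
  using powr_mono2[of \<alpha> "dist p q" 1] dist_cproj_le_1[of p q] by simp

lemma dist_le_powr: "\<lbrakk>0 < \<alpha>; \<alpha> \<le> 1\<rbrakk> \<Longrightarrow> dist p q \<le> dist p q powr \<alpha>" for p q :: "'k::finite cproj"
  using powr_mono'[of \<alpha> 1 "dist p q"] dist_cproj_le_1[of p q] by simp


abbreviation sup_norm :: "('k::finite cproj \<Rightarrow> 'b::real_normed_vector) \<Rightarrow> real" where
  "sup_norm f \<equiv> (SUP x. norm (f x))"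

text \<open>The suprema in the Hoelder norm are suprema of sets of reals, hence informative only for sets
  that are bounded above. Here boundedness of the function comes from the finite diameter of
  projective space.\<close>

lemma bdd_above_norm_holder:
  assumes "0 < \<alpha>" "f \<in> holder_space \<alpha>"
  shows "bdd_above (range (\<lambda>x. norm (f x)))"
proof -
  obtain C where C: "norm (f x - f y) \<le> C * dist x y powr \<alpha>" for x y
    using assms(2) unfolding holder_space_def by blast
  fix x0
  have "norm (f x) \<le> norm (f x0) + \<bar>C\<bar>" for x
  proof -
    have "C * dist x x0 powr \<alpha> \<le> \<bar>C\<bar> * 1"
      using powr_dist_le_1[OF assms(1), of x x0] by (intro mult_mono) auto
    with C[of x x0] norm_triangle_sub[of "f x" "f x0"] show ?thesis by linarith
  qed
  then show ?thesis by (intro bdd_aboveI2)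
qed

lemma norm_le_sup_norm: "\<lbrakk>0 < \<alpha>; f \<in> holder_space \<alpha>\<rbrakk> \<Longrightarrow> norm (f x) \<le> sup_norm f"
  by (intro cSUP_upper bdd_above_norm_holder) auto

lemma sup_norm_nonneg: "\<lbrakk>0 < \<alpha>; f \<in> holder_space \<alpha>\<rbrakk> \<Longrightarrow> 0 \<le> sup_norm f"
  by (rule order_trans[OF norm_ge_zero norm_le_sup_norm])

lemma bdd_above_holder_quotients:
  assumes "f \<in> holder_space \<alpha>"
  shows "bdd_above (insert 0 {norm (f x - f y) / dist x y powr \<alpha> | x y. x \<noteq> y})"
proof -
  obtain C where C: "norm (f x - f y) \<le> C * dist x y powr \<alpha>" for x y
    using assms unfolding holder_space_def by blast
  have "norm (f x - f y) / dist x y powr \<alpha> \<le> C" if "x \<noteq> y" for x y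
    using C[of x y] that by (simp add: pos_divide_le_eq)
  then show ?thesis
    unfolding bdd_above_insert by (intro bdd_aboveI[where M = C]) auto
qed

lemma holder_seminorm_nonneg: "f \<in> holder_space \<alpha> \<Longrightarrow> 0 \<le> holder_seminorm \<alpha> f"
  unfolding holder_seminorm_def by (intro cSup_upper bdd_above_holder_quotients) auto

lemma norm_diff_le_seminorm:
  assumes "f \<in> holder_space \<alpha>"
  shows "norm (f x - f y) \<le> holder_seminorm \<alpha> f * dist x y powr \<alpha>"
proof (cases "x = y")
  case False
  then have "norm (f x - f y) / dist x y powr \<alpha> \<le> holder_seminorm \<alpha> f"
    unfolding holder_seminorm_def by (intro cSup_upper bdd_above_holder_quotients assms) auto
  with False show ?thesis by (simp add: pos_divide_le_eq)
qed simp

lemma holder_norm_nonneg: "\<lbrakk>0 < \<alpha>; f \<in> holder_space \<alpha>\<rbrakk> \<Longrightarrow> 0 \<le> holder_norm \<alpha> f"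
  unfolding holder_norm_def by (intro add_nonneg_nonneg sup_norm_nonneg holder_seminorm_nonneg)

text \<open>All Hoelder norms below are estimated by this rule.\<close>

lemma holder_norm_le:
  assumes "\<And>x. norm (f x) \<le> a" "\<And>x y. norm (f x - f y) \<le> b * dist x y powr \<alpha>" "0 \<le> b"
  shows "f \<in> holder_space \<alpha>" "holder_norm \<alpha> f \<le> a + b"
proof -
  show "f \<in> holder_space \<alpha>" unfolding holder_space_def using assms(2) by blast
  have "sup_norm f \<le> a" using assms(1) by (intro cSUP_least) auto
  moreover have "holder_seminorm \<alpha> f \<le> b"
    unfolding holder_seminorm_def
    using assms(2,3) by (intro cSup_least) (auto simp: pos_divide_le_eq)
  ultimately show "holder_norm \<alpha> f \<le> a + b" unfolding holder_norm_def by linarith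
qed

lemma holder_const: "(\<lambda>_. c) \<in> holder_space \<alpha>"
  unfolding holder_space_def by (auto intro: exI[of _ 0])

lemma holder_norm_zero: "holder_norm \<alpha> (\<lambda>_ :: 'a::finite cproj. 0 :: 'b::real_normed_vector) = 0"
proof -
  have "insert 0 {norm (0 - 0 :: 'b) / dist x y powr \<alpha> |x y :: 'a cproj. x \<noteq> y} = {0}" by auto
  then have "holder_seminorm \<alpha> (\<lambda>_ :: 'a cproj. 0 :: 'b) = 0"
    unfolding holder_seminorm_def by (simp only: cSup_singleton)
  then show ?thesis unfolding holder_norm_def by simp
qed

text \<open>The Leibniz rule
  \<open>f x g x - f y g y = f x (g x - g y) + (f x - f y) g y\<close> makes the Hoelder norm
  submultiplicative.\<close>

lemma holder_mult:
  fixes f g :: "'k::finite cproj \<Rightarrow> 'b::real_normed_algebra"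
  assumes "0 < \<alpha>" "f \<in> holder_space \<alpha>" "g \<in> holder_space \<alpha>"
  shows "(\<lambda>x. f x * g x) \<in> holder_space \<alpha>"
    and "holder_norm \<alpha> (\<lambda>x. f x * g x) \<le> holder_norm \<alpha> f * holder_norm \<alpha> g"
proof -
  let ?S = "sup_norm f" and ?S' = "sup_norm g"
  let ?m = "holder_seminorm \<alpha> f" and ?m' = "holder_seminorm \<alpha> g"
  note pos = sup_norm_nonneg[OF assms(1,2)] sup_norm_nonneg[OF assms(1,3)]
    holder_seminorm_nonneg[OF assms(2)] holder_seminorm_nonneg[OF assms(3)]
  have 1: "norm (f x * g x) \<le> ?S * ?S'" for x
    by (rule order_trans[OF norm_mult_ineq], intro mult_mono norm_le_sup_norm[OF assms(1,2)] norm_le_sup_norm[OF assms(1,3)] pos norm_ge_zero)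
  have 2: "norm (f x * g x - f y * g y) \<le> (?S * ?m' + ?m * ?S') * dist x y powr \<alpha>" for x y
  proof -
    have "f x * g x - f y * g y = f x * (g x - g y) + (f x - f y) * g y"
      by (simp add: algebra_simps)
    then have "norm (f x * g x - f y * g y) \<le> norm (f x) * norm (g x - g y) + norm (f x - f y) * norm (g y)"
      by (simp only:) (intro norm_triangle_mono norm_mult_ineq)
    also have "\<dots> \<le> ?S * (?m' * dist x y powr \<alpha>) + (?m * dist x y powr \<alpha>) * ?S'"
      using assms pos
      by (intro add_mono mult_mono norm_le_sup_norm norm_diff_le_seminorm) auto
    finally show ?thesis by (simp add: algebra_simps)
  qed
  have 3: "0 \<le> ?S * ?m' + ?m * ?S'" using pos by simp
  show "(\<lambda>x. f x * g x) \<in> holder_space \<alpha>" by (rule holder_norm_le(1)[OF 1 2 3])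
  have "holder_norm \<alpha> (\<lambda>x. f x * g x) \<le> ?S * ?S' + (?S * ?m' + ?m * ?S')"
    by (rule holder_norm_le(2)[OF 1 2 3])
  also have "\<dots> \<le> holder_norm \<alpha> f * holder_norm \<alpha> g"
    unfolding holder_norm_def using mult_nonneg_nonneg[OF pos(3,4)] by (simp add: algebra_simps)
  finally show "holder_norm \<alpha> (\<lambda>x. f x * g x) \<le> holder_norm \<alpha> f * holder_norm \<alpha> g" .
qed

lemma holder_power:
  fixes f :: "'k::finite cproj \<Rightarrow> 'b::real_normed_algebra_1"
  assumes "0 < \<alpha>" "f \<in> holder_space \<alpha>"
  shows "(\<lambda>x. f x ^ n) \<in> holder_space \<alpha>"
  by (induction n) (simp_all add: holder_const holder_mult assms)

lemma holder_imp_continuous: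
  assumes "0 < \<alpha>" "g \<in> holder_space \<alpha>"
  shows "continuous_on UNIV g"
proof -
  obtain C where C: "norm (g x - g y) \<le> C * dist x y powr \<alpha>" for x y
    using assms(2) unfolding holder_space_def by blast
  have "((\<lambda>x. g x - g y) \<longlongrightarrow> 0) (at y)" for y
  proof (rule Lim_null_comparison[OF always_eventually[OF allI, OF C]])
    have "((\<lambda>x. dist x y powr \<alpha>) \<longlongrightarrow> dist y y powr \<alpha>) (at y)"
      using assms(1) by (intro tendsto_powr' tendsto_dist tendsto_const tendsto_ident_at) auto
    then show "((\<lambda>x. C * dist x y powr \<alpha>) \<longlongrightarrow> 0) (at y)"
      by (auto intro: tendsto_mult_right_zero)
  qed
  then show ?thesis
    by (simp add: continuous_on_def LIM_zero_iff)
qed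

section \<open>The exponential series in the algebra of Hoelder functions\<close>

definition exp_tail :: "nat \<Rightarrow> complex \<Rightarrow> complex" where
  "exp_tail N w = exp w - (\<Sum>n<N. w ^ n / fact n)"

lemma exp_tail_0: "exp_tail 0 = exp"
  by (simp add: exp_tail_def fun_eq_iff)

lemma exp_tail_Suc: "exp_tail (Suc N) w = exp_tail N w - w ^ N / fact N"
  by (simp add: exp_tail_def)

text \<open>Differentiation shifts the tail by one. The truncated subtraction covers \<open>N = 0\<close> as well,
  where the tail is the exponential function itself.\<close>

lemma DERIV_exp_tail: "(exp_tail N has_field_derivative exp_tail (N - 1) w) (at w)"
proof (induction N)
  case 0
  show ?case by (simp add: exp_tail_0)
next
  case (Suc N)
  have eq: "exp_tail (Suc N) = (\<lambda>w. exp_tail N w - w ^ N / fact N)"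
    by (simp add: exp_tail_Suc fun_eq_iff)
  show ?case
  proof (cases N)
    case 0
    then show ?thesis unfolding eq by (auto intro!: derivative_eq_intros simp: exp_tail_0)
  next
    case (Suc n)
    have "(1 + of_nat n :: complex) \<noteq> 0"
      using of_nat_neq_0[of n, where ?'a = complex] by simp
    then have "((\<lambda>w. w ^ Suc n / fact (Suc n)) has_field_derivative w ^ n / fact n) (at w)"
      by (intro DERIV_cong[OF DERIV_cdivide[OF DERIV_power_Suc[OF DERIV_ident]]]) simp
    then show ?thesis
      unfolding eq using Suc DERIV_diff[OF Suc.IH] by (simp add: exp_tail_Suc)
  qed
qed

text \<open>Taylor's estimate. For \<open>N = 0\<close>, truncated subtraction turns the denominator into \<open>0! = 1\<close> and
  the bound into \<open>exp B\<close>, so that the same formula bounds every tail.\<close>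

lemma norm_exp_tail_le:
  assumes "norm w \<le> B"
  shows "norm (exp_tail N w) \<le> exp B * B ^ N / fact (N - 1)"
proof (cases N)
  case 0
  have "norm (exp w) \<le> exp (norm w)" by (rule norm_exp)
  also have "\<dots> \<le> exp B" using assms by simp
  finally show ?thesis using 0 by (simp add: exp_tail_0)
next
  case (Suc n)
  have "norm (exp_tail N w) \<le> exp (norm w) * norm w ^ Suc n / fact n"
    using Taylor_exp_field[of w n] Suc by (simp add: exp_tail_def lessThan_Suc_atMost)
  also have "\<dots> \<le> exp B * B ^ Suc n / fact n"
    using assms by (intro divide_right_mono mult_mono power_mono) auto
  finally show ?thesis using Suc by simp
qed

text \<open>The values of \<open>u\<close> lie in a disc, on which the derivative of the tail, being the previous tail,
  gives a Lipschitz constant.\<close>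

lemma holder_exp_tail:
  fixes u :: "'k::finite cproj \<Rightarrow> complex"
  assumes "0 < \<alpha>" "u \<in> holder_space \<alpha>"
  defines "B \<equiv> sup_norm u"
  shows "(\<lambda>x. exp_tail N (u x)) \<in> holder_space \<alpha>"
    and "holder_norm \<alpha> (\<lambda>x. exp_tail N (u x)) \<le> exp B * B ^ N / fact (N - 1)
      + exp B * B ^ (N - 1) / fact (N - 1 - 1) * holder_seminorm \<alpha> u"
proof -
  let ?L = "exp B * B ^ (N - 1) / fact (N - 1 - 1)"
  have B: "norm (u x) \<le> B" for x unfolding B_def by (rule norm_le_sup_norm[OF assms(1,2)])
  have "0 \<le> B" unfolding B_def by (rule sup_norm_nonneg[OF assms(1,2)])
  then have L: "0 \<le> ?L" by simp
  have 1: "norm (exp_tail N (u x)) \<le> exp B * B ^ N / fact (N - 1)" for x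
    by (rule norm_exp_tail_le[OF B])
  have 2: "norm (exp_tail N (u x) - exp_tail N (u y)) \<le> ?L * holder_seminorm \<alpha> u * dist x y powr \<alpha>"
    for x y
  proof -
    have "norm (exp_tail N (u x) - exp_tail N (u y)) \<le> ?L * norm (u x - u y)"
    proof (rule field_differentiable_bound)
      show "convex (cball (0::complex) B)" by simp
      show "(exp_tail N has_field_derivative exp_tail (N - 1) w) (at w within cball 0 B)" for w
        by (rule has_field_derivative_at_within[OF DERIV_exp_tail])
      show "norm (exp_tail (N - 1) w) \<le> ?L" if "w \<in> cball 0 B" for w
        using that by (intro norm_exp_tail_le) simp
    qed (use B in auto)
    also have "\<dots> \<le> ?L * (holder_seminorm \<alpha> u * dist x y powr \<alpha>)"
      by (intro mult_left_mono norm_diff_le_seminorm assms L)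
    finally show ?thesis by (simp add: mult.assoc)
  qed
  have 3: "0 \<le> ?L * holder_seminorm \<alpha> u"
    by (intro mult_nonneg_nonneg L holder_seminorm_nonneg assms)
  show "(\<lambda>x. exp_tail N (u x)) \<in> holder_space \<alpha>" by (rule holder_norm_le(1)[OF 1 2 3])
  show "holder_norm \<alpha> (\<lambda>x. exp_tail N (u x)) \<le> exp B * B ^ N / fact (N - 1) + ?L * holder_seminorm \<alpha> u"
    by (rule holder_norm_le(2)[OF 1 2 3])
qed

lemma holder_norm_exp_tail_tendsto_0:
  fixes u :: "'k::finite cproj \<Rightarrow> complex"
  assumes "0 < \<alpha>" "u \<in> holder_space \<alpha>"
  shows "(\<lambda>N. holder_norm \<alpha> (\<lambda>x. exp_tail N (u x))) \<longlonglongrightarrow> 0"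
proof -
  define B where "B = sup_norm u"
  have lim: "(\<lambda>n. B ^ n / fact n) \<longlonglongrightarrow> 0"
    using summable_LIMSEQ_zero[OF summable_exp[of B]] by (simp add: field_simps)
  have "(\<lambda>N. exp B * B * (B ^ Suc N / fact (Suc N))
      + exp B * B * (B ^ N / fact N) * holder_seminorm \<alpha> u) \<longlonglongrightarrow>
      exp B * B * 0 + exp B * B * 0 * holder_seminorm \<alpha> u"
    by (intro tendsto_intros LIMSEQ_Suc lim)
  then have "(\<lambda>N. exp B * B * (B ^ Suc N / fact (Suc N))
      + exp B * B * (B ^ N / fact N) * holder_seminorm \<alpha> u) \<longlonglongrightarrow> 0" by simp
  \<comment> \<open>From index \<open>2\<close> on, neither of the truncated subtractions in the bounds is truncated.\<close>
  then have "(\<lambda>N. holder_norm \<alpha> (\<lambda>x. exp_tail (N + 2) (u x))) \<longlonglongrightarrow> 0"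
  proof (rule tendsto_sandwich[rotated 2, OF tendsto_const])
    show "\<forall>\<^sub>F N in sequentially. 0 \<le> holder_norm \<alpha> (\<lambda>x. exp_tail (N + 2) (u x))"
      by (intro always_eventually allI holder_norm_nonneg holder_exp_tail assms)
    have "holder_norm \<alpha> (\<lambda>x. exp_tail (N + 2) (u x)) \<le> exp B * B * (B ^ Suc N / fact (Suc N))
      + exp B * B * (B ^ N / fact N) * holder_seminorm \<alpha> u" for N
      using holder_exp_tail(2)[OF assms, of "N + 2"] by (simp add: B_def mult_ac)
    then show "\<forall>\<^sub>F N in sequentially. holder_norm \<alpha> (\<lambda>x. exp_tail (N + 2) (u x))
      \<le> exp B * B * (B ^ Suc N / fact (Suc N)) + exp B * B * (B ^ N / fact N) * holder_seminorm \<alpha> u"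
      by (intro always_eventually allI)
  qed
  then show ?thesis by (rule LIMSEQ_offset)
qed


section \<open>Hoelder continuity of the integrand\<close>

definition weighted_eval :: "('k::finite cproj \<Rightarrow> complex) \<Rightarrow> 'k cproj \<Rightarrow> complex^'k^'k \<Rightarrow> complex" where
  "weighted_eval g p v =
    (if v *v unit_rep p = 0 then 0
     else g (proj_act v p) * complex_of_real ((norm (v *v unit_rep p))\<^sup>2))"

lemma norm_weighted_eval_le:
  assumes "\<And>q. norm (g q) \<le> S"
  shows "norm (weighted_eval g p v) \<le> S * (norm v)\<^sup>2"
proof -
  have "0 \<le> S" using assms norm_ge_zero order_trans by blast
  then have "norm (g (proj_act v p)) * (norm (v *v unit_rep p))\<^sup>2 \<le> S * (norm v)\<^sup>2"
    by (intro mult_mono power_mono norm_matrix_unit_rep_le assms) auto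
  then show ?thesis
    using \<open>0 \<le> S\<close> by (auto simp: weighted_eval_def norm_mult norm_power)
qed

text \<open>Here the square of the weight beats the expansion: as \<open>V / a \<ge> 1\<close> and \<open>\<alpha> \<le> 2\<close>, the factor
  \<open>(V / a)\<^sup>\<alpha>\<close> is at most \<open>(V / a)\<^sup>2\<close>, and \<open>a\<^sup>2\<close> cancels.\<close>

lemma powr_quotient_mult_square_le:
  fixes a d V :: real
  assumes "0 < a" "a \<le> V" "0 \<le> d" "0 < \<alpha>" "\<alpha> \<le> 1"
  shows "(V * d / a) powr \<alpha> * a\<^sup>2 \<le> V\<^sup>2 * d powr \<alpha>"
proof -
  have "(V * d / a) powr \<alpha> = (V / a) powr \<alpha> * d powr \<alpha>"
    using assms powr_mult[of "V / a" d \<alpha>] by (simp add: mult.commute)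
  moreover have "(V / a) powr \<alpha> \<le> (V / a) powr 2"
    using assms by (intro powr_mono) auto
  moreover have "(V / a) powr 2 = (V / a)\<^sup>2"
    using assms powr_realpow[of "V / a" 2] by simp
  ultimately have "(V * d / a) powr \<alpha> * a\<^sup>2 \<le> ((V / a)\<^sup>2 * d powr \<alpha>) * a\<^sup>2"
    by (simp add: mult_right_mono)
  also have "\<dots> = V\<^sup>2 * d powr \<alpha>"
    using assms by (simp add: power_divide)
  finally show ?thesis .
qed

text \<open>Off the kernel of \<open>v\<close>, split
  \<open>g (v \<cdot> p) a\<^sup>2 - g (v \<cdot> q) b\<^sup>2 = (g (v \<cdot> p) - g (v \<cdot> q)) a\<^sup>2 + g (v \<cdot> q) (a\<^sup>2 - b\<^sup>2)\<close> with
  \<open>a = \<parallel>v x\<parallel>\<close> and \<open>b = \<parallel>v y\<parallel>\<close>. If one of the lines lies in the kernel, then \<open>a\<^sup>2 = 0\<close> or \<open>b\<^sup>2 = 0\<close>, and the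
  Lipschitz bound for the weight alone suffices.\<close>

lemma weighted_eval_diff_le:
  fixes g :: "'k::finite cproj \<Rightarrow> complex"
  assumes \<alpha>: "0 < \<alpha>" "\<alpha> \<le> 1"
    and S: "\<And>q. norm (g q) \<le> S"
    and m: "\<And>q r. norm (g q - g r) \<le> m * dist q r powr \<alpha>" "0 \<le> m"
  shows "norm (weighted_eval g p v - weighted_eval g q v) \<le> (m + 2 * S) * (norm v)\<^sup>2 * dist p q powr \<alpha>"
proof -
  let ?a = "norm (v *v unit_rep p)" and ?b = "norm (v *v unit_rep q)" and ?V = "norm v"
  have S0: "0 \<le> S" using S norm_ge_zero order_trans by blast
  have weight: "s * \<bar>?a\<^sup>2 - ?b\<^sup>2\<bar> \<le> 2 * S * ?V\<^sup>2 * dist p q powr \<alpha>" if "s \<le> S" for s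
  proof -
    have "s * \<bar>?a\<^sup>2 - ?b\<^sup>2\<bar> \<le> S * (2 * ?V\<^sup>2 * dist p q powr \<alpha>)"
      using that S0 dist_le_powr[OF \<alpha>, of p q]
      by (intro mult_mono order_trans[OF weight_diff_le] mult_left_mono) auto
    then show ?thesis by (simp add: mult_ac)
  qed
  have m0: "0 \<le> m * ?V\<^sup>2 * dist p q powr \<alpha>" using m(2) by simp
  consider "v *v unit_rep p = 0" | "v *v unit_rep q = 0"
    | "v *v unit_rep p \<noteq> 0" "v *v unit_rep q \<noteq> 0" by blast
  then show ?thesis
  proof cases
    case 1
    then have "norm (weighted_eval g p v - weighted_eval g q v) \<le> norm (g (proj_act v q)) * \<bar>?a\<^sup>2 - ?b\<^sup>2\<bar>"
      by (simp add: weighted_eval_def norm_mult norm_power)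
    with weight[OF S[of "proj_act v q"]] m0 show ?thesis by (simp add: algebra_simps)
  next
    case 2
    then have "norm (weighted_eval g p v - weighted_eval g q v) \<le> norm (g (proj_act v p)) * \<bar>?a\<^sup>2 - ?b\<^sup>2\<bar>"
      by (simp add: weighted_eval_def norm_mult norm_power)
    with weight[OF S[of "proj_act v p"]] m0 show ?thesis by (simp add: algebra_simps)
  next
    case 3
    have "weighted_eval g p v - weighted_eval g q v
        = (g (proj_act v p) - g (proj_act v q)) * complex_of_real (?a\<^sup>2)
          + g (proj_act v q) * complex_of_real (?a\<^sup>2 - ?b\<^sup>2)"
      using 3 by (simp add: weighted_eval_def algebra_simps)
    then have "norm (weighted_eval g p v - weighted_eval g q v)
        \<le> norm (g (proj_act v p) - g (proj_act v q)) * ?a\<^sup>2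
          + norm (g (proj_act v q)) * \<bar>?a\<^sup>2 - ?b\<^sup>2\<bar>"
      by (simp only: norm_triangle_mono norm_mult norm_of_real abs_power2 order_refl)
    moreover have "norm (g (proj_act v p) - g (proj_act v q)) * ?a\<^sup>2 \<le> m * ?V\<^sup>2 * dist p q powr \<alpha>"
    proof -
      have "norm (g (proj_act v p) - g (proj_act v q)) \<le> m * (?V * dist p q / ?a) powr \<alpha>"
        using dist_proj_act_le[OF 3] \<alpha>
        by (intro order_trans[OF m(1)] mult_left_mono m(2) powr_mono2) auto
      then have "norm (g (proj_act v p) - g (proj_act v q)) * ?a\<^sup>2 \<le> m * ((?V * dist p q / ?a) powr \<alpha> * ?a\<^sup>2)"
        by (simp add: mult_right_mono mult.assoc[symmetric])
      also have "\<dots> \<le> m * (?V\<^sup>2 * dist p q powr \<alpha>)"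
        using 3 \<alpha> by (intro mult_left_mono m(2) powr_quotient_mult_square_le norm_matrix_unit_rep_le) auto
      finally show ?thesis by (simp add: mult.assoc)
    qed
    ultimately show ?thesis
      using weight[OF S[of "proj_act v q"]] by (simp add: algebra_simps)
  qed
qed

section \<open>Measurability of the integrand\<close>

lemma continuous_on_matrix_vector:
  fixes x :: "complex^'k"
  shows "continuous_on A (\<lambda>v :: complex^'k^'m. v *v x)"
  unfolding matrix_vector_mult_def by (intro continuous_intros)

text \<open>The estimate \<open>d (v\<^sub>0 \<cdot> p, v \<cdot> p) \<le> \<parallel>v\<^sub>0 x - v x\<parallel> / \<parallel>v\<^sub>0 x\<parallel>\<close> has a denominator that does not depend
  on \<open>v\<close>, so the right-hand side is the distance between suitably rescaled vectors.\<close>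

lemma continuous_on_proj_act:
  "continuous_on {v. v *v unit_rep p \<noteq> 0} (\<lambda>v :: complex^'k^'k::finite. proj_act v p)"
  unfolding continuous_on_def
proof
  fix v0 :: "complex^'k^'k::finite"
  let ?U = "{v :: complex^'k^'k::finite. v *v unit_rep p \<noteq> 0}"
  assume v0: "v0 \<in> ?U"
  have "((\<lambda>v. v *v unit_rep p) \<longlongrightarrow> v0 *v unit_rep p) (at v0 within ?U)"
    using continuous_on_matrix_vector v0 unfolding continuous_on_def by blast
  then have "((\<lambda>v. v *v unit_rep p /\<^sub>R norm (v0 *v unit_rep p)) \<longlongrightarrow>
      v0 *v unit_rep p /\<^sub>R norm (v0 *v unit_rep p)) (at v0 within ?U)"
    by (intro tendsto_intros)
  then show "((\<lambda>v. proj_act v p) \<longlongrightarrow> proj_act v0 p) (at v0 within ?U)"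
  proof (rule metric_tendsto_imp_tendsto)
    have "dist (proj_act v p) (proj_act v0 p)
        \<le> dist (v *v unit_rep p /\<^sub>R norm (v0 *v unit_rep p)) (v0 *v unit_rep p /\<^sub>R norm (v0 *v unit_rep p))"
      if "v \<in> ?U" for v
    proof -
      have "dist (proj_act v0 p) (proj_act v p)
          \<le> norm (v0 *v unit_rep p - 1 *s (v *v unit_rep p)) / norm (v0 *v unit_rep p)"
        unfolding proj_act_def using v0 that by (intro dist_cproj_class_le) auto
      then show ?thesis
        by (simp add: dist_commute[of "proj_act v p"] dist_norm norm_minus_commute
            scaleR_diff_right[symmetric] divide_inverse mult.commute)
    qed
    then show "\<forall>\<^sub>F v in at v0 within ?U. dist (proj_act v p) (proj_act v0 p)
        \<le> dist (v *v unit_rep p /\<^sub>R norm (v0 *v unit_rep p)) (v0 *v unit_rep p /\<^sub>R norm (v0 *v unit_rep p))"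
      unfolding eventually_at_filter by (intro always_eventually) blast
  qed
qed

text \<open>The integrand is continuous on the open set of matrices that do not annihilate \<open>p\<close>, and zero on
  its complement.\<close>

lemma measurable_weighted_eval:
  fixes g :: "'k::finite cproj \<Rightarrow> complex"
  assumes "continuous_on UNIV g"
  shows "weighted_eval g p \<in> borel_measurable borel"
proof -
  let ?U = "{v :: complex^'k^'k. v *v unit_rep p \<noteq> 0}"
  have "open ?U"
    by (intro open_Collect_neq continuous_on_matrix_vector continuous_on_const)
  then have U: "?U \<in> sets borel" by simp
  have "continuous_on ?U (\<lambda>v. g (proj_act v p) * complex_of_real ((norm (v *v unit_rep p))\<^sup>2))"
    by (intro continuous_intros continuous_on_matrix_vector
        continuous_on_compose2[OF assms continuous_on_proj_act]) auto
  from borel_measurable_continuous_on_indicator[OF U this]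
  have "(\<lambda>v. indicator ?U v *\<^sub>R (g (proj_act v p) * complex_of_real ((norm (v *v unit_rep p))\<^sup>2)))
      \<in> borel_measurable borel" .
  also have "(\<lambda>v. indicator ?U v *\<^sub>R (g (proj_act v p) * complex_of_real ((norm (v *v unit_rep p))\<^sup>2)))
      = weighted_eval g p"
    by (auto simp: weighted_eval_def fun_eq_iff)
  finally show ?thesis .
qed

section \<open>The untilted operator and its compositions with multiplication operators\<close>

definition transfer :: "(complex^'k^'k) measure \<Rightarrow> 'k::finite fun_op" where
  "transfer \<mu> g p = (LINT v|\<mu>. weighted_eval g p v)"

lemma integrable_weighted_eval:
  fixes g :: "'k::finite cproj \<Rightarrow> complex"
  assumes "sets \<mu> = sets borel" "integrable \<mu> (\<lambda>v. (norm v)\<^sup>2)" "0 < \<alpha>" "g \<in> holder_space \<alpha>"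
  shows "integrable \<mu> (weighted_eval g p)"
proof (rule Bochner_Integration.integrable_bound)
  show "integrable \<mu> (\<lambda>v. sup_norm g * (norm v)\<^sup>2)" using assms(2) by simp
  show "weighted_eval g p \<in> borel_measurable \<mu>"
    using measurable_weighted_eval[OF holder_imp_continuous[OF assms(3,4)]]
    by (simp add: measurable_cong_sets[OF assms(1) refl])
  have "norm (weighted_eval g p v) \<le> norm (sup_norm g * (norm v)\<^sup>2)" for v
    by (rule order_trans[OF norm_weighted_eval_le[of g "sup_norm g"]])
      (simp_all add: norm_le_sup_norm[OF assms(3,4)])
  then show "AE v in \<mu>. norm (weighted_eval g p v) \<le> norm (sup_norm g * (norm v)\<^sup>2)" by simp
qed

text \<open>The constant \<open>3\<close> collects \<open>\<parallel>T g\<parallel>\<^sub>\<infinity> \<le> M \<parallel>g\<parallel>\<^sub>\<infinity>\<close> and \<open>m\<^sub>\<alpha>(T g) \<le> M (m\<^sub>\<alpha>(g) + 2 \<parallel>g\<parallel>\<^sub>\<infinity>)\<close>.\<close>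

lemma holder_transfer:
  fixes g :: "'k::finite cproj \<Rightarrow> complex"
  assumes "sets \<mu> = sets borel" "integrable \<mu> (\<lambda>v. (norm v)\<^sup>2)" "0 < \<alpha>" "\<alpha> \<le> 1" "g \<in> holder_space \<alpha>"
  defines "M \<equiv> LINT v|\<mu>. (norm v)\<^sup>2"
  shows "transfer \<mu> g \<in> holder_space \<alpha>"
    and "holder_norm \<alpha> (transfer \<mu> g) \<le> 3 * M * holder_norm \<alpha> g"
proof -
  let ?S = "sup_norm g" and ?m = "holder_seminorm \<alpha> g"
  note int = integrable_weighted_eval[OF assms(1,2,3,5)]
  have M: "0 \<le> M" unfolding M_def by simp
  have S: "norm (g q) \<le> ?S" "0 \<le> ?S" for q
    by (rule norm_le_sup_norm[OF assms(3,5)], rule sup_norm_nonneg[OF assms(3,5)])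
  have m: "norm (g q - g r) \<le> ?m * dist q r powr \<alpha>" "0 \<le> ?m" for q r
    by (rule norm_diff_le_seminorm[OF assms(5)], rule holder_seminorm_nonneg[OF assms(5)])
  have bound: "norm (LINT v|\<mu>. f v) \<le> C * M"
    if "integrable \<mu> f" "\<And>v. norm (f v) \<le> C * (norm v)\<^sup>2" for f :: "_ \<Rightarrow> complex" and C
  proof -
    have "norm (LINT v|\<mu>. f v) \<le> (LINT v|\<mu>. C * (norm v)\<^sup>2)"
      using that assms(2) by (intro Bochner_Integration.integral_norm_bound_integral) auto
    then show ?thesis by (simp add: M_def)
  qed
  have 1: "norm (transfer \<mu> g p) \<le> ?S * M" for p
    unfolding transfer_def by (intro bound int norm_weighted_eval_le S)
  have 2: "norm (transfer \<mu> g p - transfer \<mu> g q) \<le> (?m + 2 * ?S) * M * dist p q powr \<alpha>" for p q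
  proof -
    have "norm (LINT v|\<mu>. weighted_eval g p v - weighted_eval g q v)
        \<le> ((?m + 2 * ?S) * dist p q powr \<alpha>) * M"
      using weighted_eval_diff_le[OF assms(3,4) S(1) m(1) m(2), of p _ q]
      by (intro bound Bochner_Integration.integrable_diff int) (simp add: mult_ac)
    then show ?thesis
      unfolding transfer_def by (simp add: int mult_ac)
  qed
  have 3: "0 \<le> (?m + 2 * ?S) * M" using m(2) S(2) M by simp
  show "transfer \<mu> g \<in> holder_space \<alpha>" by (rule holder_norm_le(1)[OF 1 2 3])
  have "holder_norm \<alpha> (transfer \<mu> g) \<le> ?S * M + (?m + 2 * ?S) * M"
    by (rule holder_norm_le(2)[OF 1 2 3])
  also have "\<dots> \<le> 3 * M * holder_norm \<alpha> g"
    unfolding holder_norm_def using mult_nonneg_nonneg[OF m(2) M] by (simp add: algebra_simps)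
  finally show "holder_norm \<alpha> (transfer \<mu> g) \<le> 3 * M * holder_norm \<alpha> g" .
qed

text \<open>The lower bound needs a proof because \<open>endo_norm\<close> is a supremum of reals: it is informative only
  for operators that are bounded on the unit ball.\<close>

lemma endo_norm_bounds:
  fixes T :: "'k::finite fun_op"
  assumes "0 < \<alpha>" "0 \<le> K"
    and T: "\<And>f. f \<in> holder_space \<alpha> \<Longrightarrow> T f \<in> holder_space \<alpha>"
      "\<And>f. f \<in> holder_space \<alpha> \<Longrightarrow> holder_norm \<alpha> (T f) \<le> K * holder_norm \<alpha> f"
  shows "0 \<le> endo_norm \<alpha> T" "endo_norm \<alpha> T \<le> K"
proof -
  let ?B = "{f :: 'k cproj \<Rightarrow> complex. f \<in> holder_space \<alpha> \<and> holder_norm \<alpha> f \<le> 1}"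
  have zero: "(\<lambda>_. 0) \<in> ?B" by (simp add: holder_const holder_norm_zero)
  have le: "holder_norm \<alpha> (T f) \<le> K" if "f \<in> ?B" for f
    using T(2)[of f] that mult_left_mono[of "holder_norm \<alpha> f" 1 K] assms(2) by simp
  have "0 \<le> holder_norm \<alpha> (T (\<lambda>_. 0))"
    by (intro holder_norm_nonneg assms(1) T(1) holder_const)
  also have "\<dots> \<le> endo_norm \<alpha> T"
    unfolding endo_norm_def using le by (intro cSUP_upper zero bdd_aboveI2)
  finally show "0 \<le> endo_norm \<alpha> T" .
  show "endo_norm \<alpha> T \<le> K"
    unfolding endo_norm_def using zero le by (intro cSUP_least) blast+
qed

text \<open>All operators of interest, namely the tilted operators, their Taylor coefficients and the
  remainders, have the form \<open>f \<mapsto> T (u f)\<close>, and their norms are controlled by that of \<open>u\<close>.\<close>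

lemma multiplier_transfer:
  fixes u :: "'k::finite cproj \<Rightarrow> complex"
  assumes "sets \<mu> = sets borel" "integrable \<mu> (\<lambda>v. (norm v)\<^sup>2)" "0 < \<alpha>" "\<alpha> \<le> 1" "u \<in> holder_space \<alpha>"
  defines "M \<equiv> LINT v|\<mu>. (norm v)\<^sup>2"
  shows "(\<lambda>f. transfer \<mu> (\<lambda>q. u q * f q)) \<in> bounded_endos \<alpha>"
    and "0 \<le> endo_norm \<alpha> (\<lambda>f. transfer \<mu> (\<lambda>q. u q * f q))"
    and "endo_norm \<alpha> (\<lambda>f. transfer \<mu> (\<lambda>q. u q * f q)) \<le> 3 * M * holder_norm \<alpha> u"
proof -
  have M: "0 \<le> M" unfolding M_def by simp
  note uf = holder_mult[OF assms(3,5)]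
  have T: "transfer \<mu> (\<lambda>q. u q * f q) \<in> holder_space \<alpha>" if "f \<in> holder_space \<alpha>" for f
    by (intro holder_transfer assms uf that)
  have N: "holder_norm \<alpha> (transfer \<mu> (\<lambda>q. u q * f q)) \<le> 3 * M * holder_norm \<alpha> u * holder_norm \<alpha> f"
    if "f \<in> holder_space \<alpha>" for f
  proof -
    have "holder_norm \<alpha> (transfer \<mu> (\<lambda>q. u q * f q)) \<le> 3 * M * holder_norm \<alpha> (\<lambda>q. u q * f q)"
      unfolding M_def by (intro holder_transfer assms uf that)
    also have "\<dots> \<le> 3 * M * (holder_norm \<alpha> u * holder_norm \<alpha> f)"
      using M uf(2)[OF that] by (intro mult_left_mono) auto
    finally show ?thesis by (simp add: mult.assoc)
  qed
  have K: "0 \<le> 3 * M * holder_norm \<alpha> u" using M holder_norm_nonneg[OF assms(3,5)] by simp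
  have add: "transfer \<mu> (\<lambda>q. u q * (f q + g q)) p
      = transfer \<mu> (\<lambda>q. u q * f q) p + transfer \<mu> (\<lambda>q. u q * g q) p"
    if "f \<in> holder_space \<alpha>" "g \<in> holder_space \<alpha>" for f g p
  proof -
    have "weighted_eval (\<lambda>q. u q * (f q + g q)) p
        = (\<lambda>v. weighted_eval (\<lambda>q. u q * f q) p v + weighted_eval (\<lambda>q. u q * g q) p v)"
      by (auto simp: weighted_eval_def fun_eq_iff algebra_simps)
    then show ?thesis
      unfolding transfer_def
      using integrable_weighted_eval[OF assms(1-3) uf(1)[OF that(1)]]
        integrable_weighted_eval[OF assms(1-3) uf(1)[OF that(2)]] by simp
  qed
  have scale: "transfer \<mu> (\<lambda>q. u q * (c * f q)) p = c * transfer \<mu> (\<lambda>q. u q * f q) p" for c f p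
  proof -
    have "weighted_eval (\<lambda>q. u q * (c * f q)) p = (\<lambda>v. c * weighted_eval (\<lambda>q. u q * f q) p v)"
      by (auto simp: weighted_eval_def fun_eq_iff)
    then show ?thesis unfolding transfer_def by simp
  qed
  show "(\<lambda>f. transfer \<mu> (\<lambda>q. u q * f q)) \<in> bounded_endos \<alpha>"
    unfolding bounded_endos_def using T N add scale by blast
  show "0 \<le> endo_norm \<alpha> (\<lambda>f. transfer \<mu> (\<lambda>q. u q * f q))"
    "endo_norm \<alpha> (\<lambda>f. transfer \<mu> (\<lambda>q. u q * f q)) \<le> 3 * M * holder_norm \<alpha> u"
    using endo_norm_bounds[OF assms(3) K T N] by blast+
qed

text \<open>Linearity in the form needed to write the remainder of a power series of operators
  \<open>f \<mapsto> T (u f)\<close> as one such operator.\<close>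

lemma transfer_diff_sum:
  fixes F :: "'k::finite cproj \<Rightarrow> complex" and G :: "nat \<Rightarrow> 'k cproj \<Rightarrow> complex"
  assumes "sets \<mu> = sets borel" "integrable \<mu> (\<lambda>v. (norm v)\<^sup>2)" "0 < \<alpha>"
    and "F \<in> holder_space \<alpha>" "\<And>n. G n \<in> holder_space \<alpha>"
  shows "transfer \<mu> F p - (\<Sum>n<N. c n * transfer \<mu> (G n) p)
    = transfer \<mu> (\<lambda>q. F q - (\<Sum>n<N. c n * G n q)) p"
proof -
  note int = integrable_weighted_eval[OF assms(1-3)]
  have "weighted_eval (\<lambda>q. F q - (\<Sum>n<N. c n * G n q)) p
      = (\<lambda>v. weighted_eval F p v - (\<Sum>n<N. c n * weighted_eval (G n) p v))"
    by (auto simp: weighted_eval_def fun_eq_iff left_diff_distrib sum_distrib_right mult.assoc)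
  then show ?thesis
    unfolding transfer_def using int[OF assms(4)] int[OF assms(5)] by simp
qed

lemma tilted_op_eq_transfer:
  "tilted_op \<mu> h z f = transfer \<mu> (\<lambda>q. exp (z * complex_of_real (h q)) * f q)"
  "tilted_integrand h z f p = weighted_eval (\<lambda>q. exp (z * complex_of_real (h q)) * f q) p"
  by (simp_all add: fun_eq_iff tilted_op_def transfer_def tilted_integrand_def weighted_eval_def)

section \<open>Analyticity of the tilted operators\<close>

theorem theorem3p3:
  fixes \<mu> :: "(complex^'k^'k::finite) measure"
    and h :: "'k cproj \<Rightarrow> real"
    and \<alpha> :: real
  assumes "sets \<mu> = sets borel"
    and "integrable \<mu> (\<lambda>v. (norm v)\<^sup>2)"
    and "(LINT v|\<mu>. cadjoint v ** v) = mat 1"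
    and "Pur \<mu>"
    and "Erg \<mu>"
    and "0 < \<alpha>" and "\<alpha> \<le> 1"
    and "h \<in> holder_space \<alpha>"
  shows "(\<forall>z. (\<forall>f\<in>holder_space \<alpha>. \<forall>p. integrable \<mu> (tilted_integrand h z f p)) \<and>
              tilted_op \<mu> h z \<in> bounded_endos \<alpha>) \<and>
         endo_analytic_on \<alpha> (tilted_op \<mu> h) UNIV"
proof -
  note \<mu> = assms(1,2) and \<alpha> = assms(6,7)
  define M where "M = (LINT v|\<mu>. (norm v)\<^sup>2)"
  have h: "(\<lambda>q. complex_of_real (h q)) \<in> holder_space \<alpha>"
    using assms(8) unfolding holder_space_def by (simp add: of_real_diff[symmetric] del: of_real_diff)
  have zh: "(\<lambda>q. z * complex_of_real (h q)) \<in> holder_space \<alpha>" for z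
    by (intro holder_mult \<alpha> h holder_const)
  have e: "(\<lambda>q. exp (z * complex_of_real (h q))) \<in> holder_space \<alpha>" for z
    using holder_exp_tail(1)[OF \<alpha>(1) zh, of 0 z] by (simp add: exp_tail_0)
  have op: "tilted_op \<mu> h z = (\<lambda>f. transfer \<mu> (\<lambda>q. exp (z * complex_of_real (h q)) * f q))" for z
    by (rule ext) (rule tilted_op_eq_transfer)
  have "integrable \<mu> (tilted_integrand h z f p)" if "f \<in> holder_space \<alpha>" for z f p
    unfolding tilted_op_eq_transfer by (intro integrable_weighted_eval[OF \<mu> \<alpha>(1)] holder_mult \<alpha> e that)
  moreover have "tilted_op \<mu> h z \<in> bounded_endos \<alpha>" for z
    unfolding op by (rule multiplier_transfer(1)[OF \<mu> \<alpha> e])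
  moreover have "endo_analytic_on \<alpha> (tilted_op \<mu> h) UNIV"
    unfolding endo_analytic_on_def
  proof (intro ballI)
    fix z0 :: complex
    \<comment> \<open>The Taylor coefficients of \<open>z \<mapsto> exp (z h)\<close> at \<open>z0\<close>.\<close>
    define a where "a n q = complex_of_real (h q) ^ n * inverse (fact n) * exp (z0 * complex_of_real (h q))" for n q
    have a: "a n \<in> holder_space \<alpha>" for n
      unfolding a_def by (intro holder_mult holder_power holder_const h e \<alpha>)
    define A where "A n f = transfer \<mu> (\<lambda>q. a n q * f q)" for n f
    have bounded: "A n \<in> bounded_endos \<alpha>" for n
      unfolding A_def by (rule multiplier_transfer(1)[OF \<mu> \<alpha> a])
    have conv: "(\<lambda>N. endo_norm \<alpha> (\<lambda>f x. tilted_op \<mu> h z f x - (\<Sum>n<N. (z - z0) ^ n * A n f x))) \<longlonglongrightarrow> 0"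
      for z
    proof -
      define t where "t N q = exp_tail N ((z - z0) * complex_of_real (h q))" for N q
      \<comment> \<open>The multiplier of the remainder, \<open>exp (z0 h)\<close> times the tail at \<open>(z - z0) h\<close>.\<close>
      define r where "r N q = exp (z0 * complex_of_real (h q)) * t N q" for N q
      have t: "t N \<in> holder_space \<alpha>" for N
        unfolding t_def by (rule holder_exp_tail(1)[OF \<alpha>(1) zh])
      have r: "r N \<in> holder_space \<alpha>" for N
        unfolding r_def by (intro holder_mult \<alpha> e t)
      have r_eq: "r N q = exp (z * complex_of_real (h q)) - (\<Sum>n<N. (z - z0) ^ n * a n q)" for N q
      proof -
        have "exp (z0 * complex_of_real (h q)) * exp ((z - z0) * complex_of_real (h q)) = exp (z * complex_of_real (h q))"
          by (simp add: exp_add[symmetric] algebra_simps)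
        then show ?thesis
          by (simp add: r_def t_def exp_tail_def a_def right_diff_distrib sum_distrib_left
              power_mult_distrib divide_inverse mult_ac)
      qed
      have "endo_norm \<alpha> (\<lambda>f x. tilted_op \<mu> h z f x - (\<Sum>n<N. (z - z0) ^ n * A n f x))
          = endo_norm \<alpha> (\<lambda>f. transfer \<mu> (\<lambda>q. r N q * f q))" for N
      proof -
        have "(\<lambda>x. tilted_op \<mu> h z f x - (\<Sum>n<N. (z - z0) ^ n * A n f x)) = transfer \<mu> (\<lambda>q. r N q * f q)"
          if "f \<in> holder_space \<alpha>" for f
        proof
          fix x
          have "tilted_op \<mu> h z f x - (\<Sum>n<N. (z - z0) ^ n * A n f x)
              = transfer \<mu> (\<lambda>q. exp (z * complex_of_real (h q)) * f q - (\<Sum>n<N. (z - z0) ^ n * (a n q * f q))) x"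
            unfolding op A_def by (intro transfer_diff_sum[OF \<mu> \<alpha>(1)] holder_mult \<alpha> e a that)
          then show "tilted_op \<mu> h z f x - (\<Sum>n<N. (z - z0) ^ n * A n f x) = transfer \<mu> (\<lambda>q. r N q * f q) x"
            by (simp add: r_eq left_diff_distrib sum_distrib_right mult.assoc)
        qed
        then show ?thesis unfolding endo_norm_def by (intro SUP_cong) auto
      qed
      moreover have "(\<lambda>N. endo_norm \<alpha> (\<lambda>f. transfer \<mu> (\<lambda>q. r N q * f q))) \<longlonglongrightarrow> 0"
      proof (rule tendsto_sandwich[OF _ _ tendsto_const])
        show "\<forall>\<^sub>F N in sequentially. 0 \<le> endo_norm \<alpha> (\<lambda>f. transfer \<mu> (\<lambda>q. r N q * f q))"
          by (intro always_eventually allI multiplier_transfer(2)[OF \<mu> \<alpha> r])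
        let ?E = "holder_norm \<alpha> (\<lambda>q. exp (z0 * complex_of_real (h q)))"
        have "endo_norm \<alpha> (\<lambda>f. transfer \<mu> (\<lambda>q. r N q * f q)) \<le> 3 * M * (?E * holder_norm \<alpha> (t N))" for N
        proof -
          have "endo_norm \<alpha> (\<lambda>f. transfer \<mu> (\<lambda>q. r N q * f q)) \<le> 3 * M * holder_norm \<alpha> (r N)"
            unfolding M_def by (rule multiplier_transfer(3)[OF \<mu> \<alpha> r])
          also have "\<dots> \<le> 3 * M * (?E * holder_norm \<alpha> (t N))"
            unfolding r_def by (intro mult_left_mono holder_mult \<alpha> e t) (simp add: M_def)
          finally show ?thesis .
        qed
        then show "\<forall>\<^sub>F N in sequentially. endo_norm \<alpha> (\<lambda>f. transfer \<mu> (\<lambda>q. r N q * f q))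
            \<le> 3 * M * (?E * holder_norm \<alpha> (t N))"
          by (intro always_eventually allI)
        have "(\<lambda>N. holder_norm \<alpha> (t N)) \<longlonglongrightarrow> 0"
          unfolding t_def by (rule holder_norm_exp_tail_tendsto_0[OF \<alpha>(1) zh])
        then show "(\<lambda>N. 3 * M * (?E * holder_norm \<alpha> (t N))) \<longlonglongrightarrow> 0"
          by (intro tendsto_mult_right_zero)
      qed
      ultimately show ?thesis by simp
    qed
    show "\<exists>r>0. \<exists>A. (\<forall>n. A n \<in> bounded_endos \<alpha>) \<and> (\<forall>z\<in>ball z0 r.
        (\<lambda>N. endo_norm \<alpha> (\<lambda>f x. tilted_op \<mu> h z f x - (\<Sum>n<N. (z - z0) ^ n * A n f x))) \<longlonglongrightarrow> 0)"
      \<comment> \<open>The series converges everywhere, so any radius serves.\<close>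
      using bounded conv zero_less_one by blast
  qed
  ultimately show ?thesis by blast
qed

end
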